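(* Let $k\ge 2$ be an integer. There exists a set $A\subset \mathbb{N}_0$ such that $A^k + A = \mathbb{N}_0$ and, for some constant $C>0$ and all sufficiently large $X$, $$A(X) \le C\,\frac{\sqrt{X}}{(\log X)^{\alpha(k)}}, \qquad \text{where } \alpha(k) = \frac{k-2}{k+1}.$$
   Context: $\mathbb{N}_0$ is the set of nonnegative integers. For sets $A,B$ of integers, $AB=\{ab: a\in A, b\in B\}$, $A+B=\{a+b\}$, $A^1=A$ and $A^k = A A^{k-1}$ for $k>1$. For $A\subset\mathbb{N}_0$ and $X>0$, $A(X)=|A\cap[1,X]|$. *)

theory Defs
  imports Complex_Main
begin

definition setprod :: "nat set \<Rightarrow> nat set \<Rightarrow> nat set" where
  "setprod A B = {a * b | a b. a \<in> A \<and> b \<in> B}"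

definition setsum :: "nat set \<Rightarrow> nat set \<Rightarrow> nat set" where
  "setsum A B = {a + b | a b. a \<in> A \<and> b \<in> B}"

fun setpow :: "nat set \<Rightarrow> nat \<Rightarrow> nat set" where
  "setpow A 0 = A"
| "setpow A (Suc 0) = A"
| "setpow A (Suc k) = setprod A (setpow A k)"

definition countfn :: "nat set \<Rightarrow> real \<Rightarrow> nat" where
  "countfn A X = card {n \<in> A. 1 \<le> n \<and> real n \<le> X}"

end

theory Submission
  imports Defs "HOL-Analysis.Harmonic_Numbers" "HOL-Computational_Algebra.Primes"
    "HOL-Library.Infinite_Set" "HOL-Real_Asymp.Real_Asymp"
begin

text \<open>
  Write \<open>L = ln X\<close> and \<open>\<alpha> = \<alpha>(k)\<close>. Chebyshev's estimate gives odd primes \<open>p\<^sub>n = O(n\<^sup>2)\<close>, and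
  multiplying \<open>p\<^sub>n\<close> by a power of 2 yields \<open>d\<^sub>n\<close> of order \<open>n\<^sup>2 (ln n)\<^bsup>2\<alpha>\<^esup>\<close>, so that the set \<open>D\<close> of
  all \<open>d\<^sub>n\<close> has \<open>O(\<surd>X / L\<^bsup>\<alpha>\<^esup>)\<close> elements up to \<open>X\<close>. The odd prime in each factor makes products of
  \<open>k\<close> elements of \<open>D\<close> essentially unique, so \<open>D\<^bsup>k\<^esup>\<close> has at least \<open>c \<surd>X L\<^bsup>k-1-k\<alpha>\<^esup>\<close> elements up to
  \<open>X\<close>, and \<open>k - 1 - k \<alpha> = 1 + \<alpha>\<close>. Lorentz's greedy covering argument, which loses one logarithm,
  then provides an additive complement \<open>B\<close> of \<open>D\<^bsup>k\<^esup>\<close> with \<open>O(\<surd>X / L\<^bsup>\<alpha>\<^esup>)\<close> elements up to \<open>X\<close>,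
  and \<open>A\<close> is the union of \<open>D\<close>, \<open>B\<close> and an initial segment.
\<close>

section \<open>A weak form of Chebyshev's estimate\<close>

text \<open>Legendre's formula, cut off at \<open>N\<close>. Passing from \<open>n\<close> to
  \<open>Suc n\<close> raises the \<open>i\<close>-th quotient by one exactly when
  \<open>p ^ i\<close> divides \<open>Suc n\<close>, and the number of such \<open>i\<close> is the
  multiplicity of \<open>p\<close> in \<open>Suc n\<close>.\<close>

lemma multiplicity_fact:
  fixes p n N :: nat
  assumes p: "prime p"
  shows "n < p ^ N \<Longrightarrow> multiplicity p (fact n :: nat) = (\<Sum>i=1..N. n div p ^ i)"
proof (induction n)
  case (Suc n)
  have "multiplicity p (Suc n) \<le> N"
  proof (rule ccontr)
    assume "\<not> multiplicity p (Suc n) \<le> N"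
    then have "p ^ N dvd Suc n"
      by (intro multiplicity_dvd') simp
    then have "p ^ N \<le> Suc n" by (rule dvd_imp_le) simp
    then show False using Suc.prems by simp
  qed
  moreover have "p ^ i dvd Suc n \<longleftrightarrow> i \<le> multiplicity p (Suc n)" for i
    by (rule power_dvd_iff_le_multiplicity) (use p in auto)
  then have "{i\<in>{1..N}. p ^ i dvd Suc n} = {i\<in>{1..N}. i \<le> multiplicity p (Suc n)}"
    by (simp only:)
  ultimately have "card {i\<in>{1..N}. p ^ i dvd Suc n} = card {1..multiplicity p (Suc n)}"
    by (intro arg_cong[of _ _ card]) force
  then have "multiplicity p (Suc n) = (\<Sum>i=1..N. if p ^ i dvd Suc n then 1 else 0)"
    by (simp add: sum.If_cases Int_def del: of_nat_Suc)
  then have "multiplicity p (Suc n) + (\<Sum>i=1..N. n div p ^ i)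
      = (\<Sum>i=1..N. (if p ^ i dvd Suc n then 1 else 0) + n div p ^ i)"
    by (simp add: sum.distrib)
  also have "\<dots> = (\<Sum>i=1..N. Suc n div p ^ i)"
    by (intro sum.cong) (auto simp: div_Suc dvd_eq_mod_eq_0)
  finally show ?case
    using Suc p by (simp add: prime_elem_multiplicity_mult_distrib del: of_nat_Suc mult_Suc)
qed simp

text \<open>By Legendre's formula the exponent of \<open>p\<close> is a sum of terms
  \<open>2 * n div p ^ i - 2 * (n div p ^ i)\<close>, each at most 1 and zero once
  \<open>p ^ i > 2 * n\<close>. So it is at most the number of \<open>i \<ge> 1\<close> with
  \<open>p ^ i \<le> 2 * n\<close>.\<close>

lemma prime_power_central_binomial_le:
  fixes p n :: nat
  assumes p: "prime p" and n: "n > 0"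
  shows "p ^ multiplicity p (2 * n choose n) \<le> 2 * n"
proof -
  let ?b = "2 * n choose n" and ?v = "multiplicity p (2 * n choose n)"
  \<comment> \<open>A generous cutoff: \<open>2 ^ N > N\<close> makes it valid for both factorials
    and every prime.\<close>
  define N where "N = 2 * n"
  have N: "2 * n < p ^ N" "n < p ^ N"
  proof -
    have "N < 2 ^ N" by (rule less_exp)
    also have "2 ^ N \<le> p ^ N" using prime_ge_2_nat[OF p] by (intro power_mono) auto
    finally show "2 * n < p ^ N" "n < p ^ N" by (auto simp: N_def)
  qed
  have b: "fact n * fact n * ?b = fact (2 * n)"
    using binomial_fact_lemma[of n "2 * n"] by simp
  have "multiplicity p (fact (2 * n) :: nat)
      = multiplicity p (fact n :: nat) + multiplicity p (fact n :: nat) + ?v"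
    unfolding b[symmetric] using p by (simp add: prime_elem_multiplicity_mult_distrib)
  then have v: "?v = (\<Sum>i=1..N. 2 * n div p ^ i) - 2 * (\<Sum>i=1..N. n div p ^ i)"
    by (simp only: multiplicity_fact[OF p N(1)] multiplicity_fact[OF p N(2)])
  also have "\<dots> \<le> (\<Sum>i=1..N. if p ^ i \<le> 2 * n then 1 else 0)"
  proof -
    have "2 * n div p ^ i \<le> 2 * (n div p ^ i) + (if p ^ i \<le> 2 * n then 1 else 0)" for i
    proof (cases "p ^ i \<le> 2 * n")
      case True
      have "2 * n = p ^ i * (2 * (n div p ^ i)) + 2 * (n mod p ^ i)"
        using mult_div_mod_eq[of "p ^ i" n] by (metis add_mult_distrib2 mult.left_commute)
      moreover have "n mod p ^ i < p ^ i" using p by (simp add: prime_gt_0_nat)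
      ultimately have "2 * n < p ^ i * (2 * (n div p ^ i) + 2)"
        by (simp add: distrib_left)
      then have "2 * n div p ^ i < 2 * (n div p ^ i) + 2"
        by (simp add: div_less_iff_less_mult less_mult_imp_div_less mult.commute)
      then show ?thesis using True by simp
    qed simp
    then have "(\<Sum>i=1..N. 2 * n div p ^ i)
        \<le> (\<Sum>i=1..N. 2 * (n div p ^ i) + (if p ^ i \<le> 2 * n then 1 else 0))"
      by (rule sum_mono)
    then show ?thesis by (simp add: sum.distrib sum_distrib_left)
  qed
  also have "\<dots> = card {i\<in>{1..N}. p ^ i \<le> 2 * n}"
    by (simp add: sum.If_cases Int_def)
  finally have le: "?v \<le> card {i\<in>{1..N}. p ^ i \<le> 2 * n}" .
  show ?thesis
  proof (rule ccontr)
    assume *: "\<not> p ^ ?v \<le> 2 * n"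
    \<comment> \<open>If \<open>p ^ ?v\<close> exceeded \<open>2 * n\<close>, only exponents from 1
      to \<open>?v - 1\<close> would be counted. This forces \<open>?v = 0\<close>, where the power
      is 1.\<close>
    have "{i\<in>{1..N}. p ^ i \<le> 2 * n} \<subseteq> {1..<?v}"
    proof safe
      fix i assume "i \<in> {1..N}" "p ^ i \<le> 2 * n"
      then have "p ^ i < p ^ ?v" using * by linarith
      then have "i < ?v" using p by (simp add: prime_gt_Suc_0_nat)
      then show "i \<in> {1..<?v}" using \<open>i \<in> {1..N}\<close> by simp
    qed
    from card_mono[OF _ this] le have "?v = 0" by simp
    then show False using * n by simp
  qed
qed

text \<open>Each prime factor of the binomial coefficient is at most \<open>2 * n\<close>, and so is
  its full contribution to the factorization.\<close>

lemma central_binomial_le_power_card_primes: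
  fixes n :: nat
  assumes n: "n > 0"
  shows "2 * n choose n \<le> (2 * n) ^ card {p. prime p \<and> p \<le> 2 * n}"
proof -
  let ?b = "2 * n choose n"
  have b: "?b > 0" by (simp add: n)
  have sub: "prime_factors ?b \<subseteq> {p. prime p \<and> p \<le> 2 * n}"
  proof
    fix p assume pb: "p \<in> prime_factors ?b"
    then have p: "prime p" "p dvd ?b" by (auto simp: prime_factors_dvd)
    then have "p ^ 1 \<le> p ^ multiplicity p ?b"
      using b by (intro power_increasing) (auto simp: Suc_le_eq prime_multiplicity_gt_zero_iff prime_gt_0_nat Suc_leI)
    also have "\<dots> \<le> 2 * n" by (rule prime_power_central_binomial_le[OF p(1) n])
    finally show "p \<in> {p. prime p \<and> p \<le> 2 * n}" using p by simp
  qed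
  have "?b = (\<Prod>p\<in>prime_factors ?b. p ^ multiplicity p ?b)"
    using b by (intro prime_factorization_nat)
  also have "\<dots> \<le> (\<Prod>p\<in>prime_factors ?b. 2 * n)"
    by (intro prod_mono) (auto intro!: prime_power_central_binomial_le n)
  also have "\<dots> = (2 * n) ^ card (prime_factors ?b)" by simp
  also have "\<dots> \<le> (2 * n) ^ card {p. prime p \<and> p \<le> 2 * n}"
    using n sub by (intro power_increasing card_mono) auto
  finally show ?thesis .
qed

text \<open>Compare logarithms in \<open>4 ^ n \<le> 2 * n * (2 * n choose n) \<le> (2 * n) ^
  (?\<pi> + 1)\<close>. Bounding \<open>ln (2 * n)\<close> by \<open>2 * sqrt (2 * n)\<close> gives
  up most of Chebyshev's estimate, but primes of quadratic growth are all that is wanted.\<close>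

lemma sqrt_le_card_primes:
  assumes n: "n > 0"
  shows "sqrt (real (2 * n)) / 4 \<le> real (card {p. prime p \<and> p \<le> 2 * n}) + 1"
proof -
  let ?\<pi> = "card {p::nat. prime p \<and> p \<le> 2 * n}"
  have "4 ^ n \<le> real (2 * n) * real (2 * n choose n)"
    using central_binomial_lower_bound[OF n] n by (simp add: field_simps)
  also have "\<dots> \<le> real (2 * n) * real ((2 * n) ^ ?\<pi>)"
    using central_binomial_le_power_card_primes[OF n] by (intro mult_left_mono) (simp_all only: of_nat_le_iff of_nat_0_le_iff)
  also have "\<dots> = real (2 * n) ^ (?\<pi> + 1)" by simp
  finally have "ln (4 ^ n) \<le> ln (real (2 * n) ^ (?\<pi> + 1))"
    using n by (subst ln_le_cancel_iff) auto
  then have "real n * ln 4 \<le> (real ?\<pi> + 1) * ln (real (2 * n))"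
    using n by (simp only: ln_realpow of_nat_add of_nat_1)
  moreover have "1 \<le> ln (4::real)"
    using exp_le by (simp add: ln_ge_iff)
  ultimately have "real n \<le> (real ?\<pi> + 1) * ln (real (2 * n))"
    using mult_left_mono[of 1 "ln 4" "real n"] by simp
  also have "ln (real (2 * n)) \<le> 2 * sqrt (real (2 * n))"
    using ln_le_minus_one[of "sqrt (real (2 * n))"] n by (simp add: ln_sqrt)
  finally have "real n \<le> (real ?\<pi> + 1) * (2 * sqrt (real (2 * n)))"
    by (simp add: mult_left_mono)
  moreover have "2 * real n = sqrt (real (2 * n)) * sqrt (real (2 * n))" by simp
  ultimately have "sqrt (real (2 * n)) * sqrt (real (2 * n)) \<le> (4 * (real ?\<pi> + 1)) * sqrt (real (2 * n))"
    by (simp add: algebra_simps)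
  then have "sqrt (real (2 * n)) \<le> 4 * (real ?\<pi> + 1)"
    using n by (subst (asm) mult_le_cancel_right_pos) auto
  then show ?thesis by simp
qed

section \<open>Growth of the odd primes\<close>

lemma enumerate_le:
  fixes S :: "nat set"
  assumes "infinite S" "m < card {x\<in>S. x \<le> y}"
  shows "enumerate S m \<le> y"
proof (rule ccontr)
  assume *: "\<not> enumerate S m \<le> y"
  have "{x\<in>S. x \<le> y} \<subseteq> enumerate S ` {..<m}"
  proof
    fix x assume "x \<in> {x\<in>S. x \<le> y}"
    moreover then obtain i where "enumerate S i = x"
      using enumerate_Ex[OF assms(1), of x] by blast
    ultimately have "enumerate S i < enumerate S m" using * by auto
    then have "i < m" using assms(1) by (simp add: enumerate_mono_iff)
    then show "x \<in> enumerate S ` {..<m}" using \<open>enumerate S i = x\<close> by blast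
  qed
  from surj_card_le[OF _ this] assms(2) show False by simp
qed

lemma odd_prime_sequence:
  obtains p :: "nat \<Rightarrow> nat" where "inj p" "\<And>m. prime (p m)" "\<And>m. odd (p m)"
    "\<And>m. p m \<le> 16 * (m + 3)\<^sup>2"
proof -
  define S where "S = {p::nat. prime p} - {2}"
  have inf: "infinite S"
    unfolding S_def using primes_infinite by (simp add: infinite_remove)
  have S: "prime (enumerate S m) \<and> odd (enumerate S m)" for m
    using enumerate_in_set[OF inf, of m] prime_odd_nat[of "enumerate S m"] prime_ge_2_nat[of "enumerate S m"] by (force simp: S_def)
  have "enumerate S m \<le> 16 * (m + 3)\<^sup>2" for m
  proof (rule enumerate_le[OF inf])
    \<comment> \<open>Chosen so that \<open>sqrt (2 * n) / 4 = m + 3\<close>. There are then at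
      least \<open>m + 2\<close> primes up to \<open>2 * n\<close>, hence at least
      \<open>m + 1\<close> odd ones, as needed for an enumeration that starts at 0.\<close>
    define n where "n = 8 * (m + 3)\<^sup>2"
    have "real (m + 3) = sqrt (real (2 * n)) / 4"
      by (simp add: n_def real_sqrt_mult)
    also have "\<dots> \<le> real (card {p::nat. prime p \<and> p \<le> 2 * n}) + 1"
      by (rule sqrt_le_card_primes) (simp add: n_def)
    also have "card {p::nat. prime p \<and> p \<le> 2 * n} \<le> card (insert 2 {x\<in>S. x \<le> 2 * n})"
      by (intro card_mono) (auto simp: S_def)
    also have "\<dots> \<le> Suc (card {x\<in>S. x \<le> 2 * n})" by (rule card_insert_le_m1) auto
    finally show "m < card {x\<in>S. x \<le> 16 * (m + 3)\<^sup>2}" by (simp add: n_def)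
  qed
  then show ?thesis
    using that[of "enumerate S"] S inf by (auto simp: strict_mono_enumerate strict_mono_imp_inj_on)
qed

section \<open>Counting products\<close>

lemma finite_nat_le_real: "finite {n::nat. n \<ge> 1 \<and> real n \<le> Y}"
  by (rule finite_subset[of _ "{..nat \<lfloor>Y\<rfloor>}"]) (auto simp: le_nat_floor)

text \<open>The products of \<open>q i (n i)\<close> over \<open>i \<le> m\<close>, where the
  indices \<open>n i \<ge> 1\<close> have product at most \<open>Y\<close>: a hyperbolic region.
  Parameter \<open>m\<close> means \<open>m + 1\<close> factors, each position \<open>i\<close>
  having its own family \<open>q i\<close>.\<close>

fun box_products :: "(nat \<Rightarrow> nat \<Rightarrow> nat) \<Rightarrow> nat \<Rightarrow> real \<Rightarrow> nat set" where
  "box_products q 0 Y = q 0 ` {n. n \<ge> 1 \<and> real n \<le> Y}"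
| "box_products q (Suc m) Y =
    (\<Union>n\<in>{n. n \<ge> 1 \<and> real n \<le> Y}. (*) (q (Suc m) n) ` box_products q m (Y / real n))"

lemma finite_box_products: "finite (box_products q m Y)"
  by (induction m arbitrary: Y) (auto simp: finite_nat_le_real[simplified])

lemma box_products_pos:
  assumes "\<And>i n. q i n > 0" "s \<in> box_products q m Y"
  shows "s > 0"
  using assms by (induction m arbitrary: Y s) auto

lemma box_products_subset_setpow:
  assumes "\<And>i n. i \<le> m \<Longrightarrow> n \<ge> 1 \<Longrightarrow> q i n \<in> D"
  shows "box_products q m Y \<subseteq> setpow D (Suc m)"
  using assms by (induction m arbitrary: Y) (fastforce simp: setprod_def)+

text \<open>The factors are at most \<open>M\<close> times the squares of indices whose product is
  at most \<open>Y\<close>. The separate bound \<open>Z\<close> survives the induction, since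
  dividing \<open>Y\<close> by an index only shrinks it.\<close>

lemma box_products_le:
  fixes M :: real
  assumes "M \<ge> 0" "\<And>i n. i \<le> m \<Longrightarrow> n \<ge> 1 \<Longrightarrow> real n \<le> Z \<Longrightarrow> real (q i n) \<le> M * real n ^ 2"
    and "Y \<le> Z" "s \<in> box_products q m Y"
  shows "real s \<le> M ^ Suc m * Y ^ 2"
  using assms
proof (induction m arbitrary: Y s)
  case 0
  then obtain n where n: "n \<ge> 1" "real n \<le> Y" "s = q 0 n" by auto
  have "real s \<le> M * real n ^ 2" using 0(2)[of 0 n] n 0 by simp
  also have "\<dots> \<le> M * Y ^ 2" using n 0 by (intro mult_left_mono power_mono) auto
  finally show ?case by simp
next
  case (Suc m)
  then obtain n t where n: "n \<ge> 1" "real n \<le> Y" "t \<in> box_products q m (Y / real n)"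
      and s: "s = q (Suc m) n * t" by auto
  have "Y / real n \<le> Y / 1" using n by (intro divide_left_mono) auto
  then have "real t \<le> M ^ Suc m * (Y / real n) ^ 2"
    using Suc n by (intro Suc.IH) auto
  moreover have "real (q (Suc m) n) \<le> M * real n ^ 2"
    using Suc n by auto
  ultimately have "real s \<le> (M * real n ^ 2) * (M ^ Suc m * (Y / real n) ^ 2)"
    unfolding s of_nat_mult using Suc by (intro mult_mono) auto
  also have "\<dots> = M ^ Suc (Suc m) * Y ^ 2" using n by (simp add: field_simps power2_eq_square)
  finally show ?case .
qed

text \<open>In the next lemmas the prime \<open>r i n\<close> marks the factor \<open>q i n\<close>, so that a product determines its factors.\<close>

lemma prime_not_dvd_box_products:
  assumes "prime r" "\<And>i n. i \<le> m \<Longrightarrow> \<not> r dvd q i n" "s \<in> box_products q m Y"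
  shows "\<not> r dvd s"
  using assms by (induction m arbitrary: Y s) (auto simp: prime_dvd_mult_iff)

lemma card_box_products_Suc:
  assumes r: "\<And>i n. prime (r i n)"
      "\<And>i j n n'. i \<le> Suc m \<Longrightarrow> j \<le> Suc m \<Longrightarrow> r i n dvd q j n' \<longleftrightarrow> i = j \<and> n = n'"
    and q: "\<And>i n. q i n > 0"
  shows "card (box_products q (Suc m) Y)
    = (\<Sum>n | n \<ge> 1 \<and> real n \<le> Y. card (box_products q m (Y / real n)))"
proof -
  have "card (box_products q (Suc m) Y)
    = (\<Sum>n | n \<ge> 1 \<and> real n \<le> Y. card ((*) (q (Suc m) n) ` box_products q m (Y / real n)))"
    unfolding box_products.simps
  proof (intro card_UN_disjoint finite_nat_le_real ballI impI finite_imageI finite_box_products equals0I)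
    fix n n' x
    assume "n \<noteq> n'" and "x \<in> (*) (q (Suc m) n) ` box_products q m (Y / real n)
      \<inter> (*) (q (Suc m) n') ` box_products q m (Y / real n')"
    then obtain s s' where s': "s' \<in> box_products q m (Y / real n')"
      and eq: "q (Suc m) n * s = q (Suc m) n' * s'" by auto
    \<comment> \<open>The marker of the last factor on the left divides neither
      \<open>q (Suc m) n'\<close>, as the indices differ, nor \<open>s'\<close>, which is built from
      other positions.\<close>
    have "r (Suc m) n dvd q (Suc m) n * s" using r(2) by simp
    then have "r (Suc m) n dvd q (Suc m) n' * s'" by (simp only: eq)
    then have "r (Suc m) n dvd s'" using r \<open>n \<noteq> n'\<close> by (simp add: prime_dvd_mult_iff)
    moreover have "\<not> r (Suc m) n dvd s'"
      by (rule prime_not_dvd_box_products[OF _ _ s']) (auto simp: r)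
    ultimately show False by contradiction
  qed
  also have "\<dots> = (\<Sum>n | n \<ge> 1 \<and> real n \<le> Y. card (box_products q m (Y / real n)))"
  proof (intro sum.cong refl card_image)
    show "inj_on ((*) (q (Suc m) n)) A" for n A
      using q[of "Suc m" n] by (simp add: inj_on_def)
  qed
  finally show ?thesis .
qed

text \<open>Induction over the recursion for the cardinality, keeping only
  \<open>n \<le> sqrt Y\<close> for the last index. There \<open>ln (Y / n)\<close> is still at
  least \<open>ln Y / 2\<close>, and the harmonic sum over these \<open>n\<close> supplies one more
  factor \<open>ln Y / 2\<close>.\<close>

lemma card_box_products_ge:
  assumes r: "\<And>i n. prime (r i n)"
      "\<And>i j n n'. i \<le> m \<Longrightarrow> j \<le> m \<Longrightarrow> r i n dvd q j n' \<longleftrightarrow> i = j \<and> n = n'"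
    and q: "\<And>i n. q i n > 0"
  shows "\<exists>c>0. \<forall>Y\<ge>1. real (card (box_products q m Y)) \<ge> c * Y * ln Y ^ m"
  using r
proof (induction m)
  case 0
  have "1 / 2 * Y \<le> real (card (box_products q 0 Y))" if "Y \<ge> 1" for Y
  proof -
    have "inj (q 0)" using 0(2) by (metis injI le_refl)
    then have "card (box_products q 0 Y) = card {n. n \<ge> 1 \<and> real n \<le> Y}"
      by (simp add: card_image inj_on_subset)
    also have "{n. n \<ge> 1 \<and> real n \<le> Y} = {1..nat \<lfloor>Y\<rfloor>}"
      using that by (auto simp: le_nat_floor) linarith
    finally have "card (box_products q 0 Y) = nat \<lfloor>Y\<rfloor>" by simp
    moreover have "1 \<le> \<lfloor>Y\<rfloor>" using that by simp
    ultimately show ?thesis by linarith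
  qed
  then show ?case by (intro exI[of _ "1/2"]) auto
next
  case (Suc m)
  then obtain c where c: "c > 0" "\<And>Y. Y \<ge> 1 \<Longrightarrow> c * Y * ln Y ^ m \<le> real (card (box_products q m Y))"
    by (metis le_SucI)
  have "c / 2 ^ Suc m * Y * ln Y ^ Suc m \<le> real (card (box_products q (Suc m) Y))" if Y: "Y \<ge> 1" for Y
  proof -
    define N where "N = nat \<lfloor>sqrt Y\<rfloor>"
    have N: "real N \<le> sqrt Y" "sqrt Y \<le> real N + 1"
      using Y by (auto simp: N_def of_nat_floor)
    have sq: "sqrt Y \<le> Y" "sqrt Y * sqrt Y = Y" using Y sqrt_le_D by (auto intro: real_le_lsqrt simp: power2_eq_square)
    have "ln Y / 2 \<le> ln (real N + 1)"
      using N Y by (subst ln_sqrt[symmetric]) auto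
    also have "\<dots> \<le> harm N" by (rule harm_ge_ln)
    finally have harm: "ln Y / 2 \<le> harm N" .
    have "c / 2 ^ Suc m * Y * ln Y ^ Suc m = c * Y * (ln Y / 2) ^ m * (ln Y / 2)"
      by (simp add: power_divide mult_ac)
    also have "\<dots> \<le> c * Y * (ln Y / 2) ^ m * harm N"
      using c Y harm by (intro mult_left_mono) auto
    also have "\<dots> = (\<Sum>n=1..N. c * (Y / real n) * (ln Y / 2) ^ m)"
      by (simp add: harm_def sum_distrib_left sum_distrib_right field_simps)
    also have "\<dots> \<le> (\<Sum>n=1..N. real (card (box_products q m (Y / real n))))"
    proof (rule sum_mono)
      fix n assume n: "n \<in> {1..N}"
      then have "real n \<le> sqrt Y" using N by simp
      then have Yn: "sqrt Y \<le> Y / real n"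
        using n sq Y mult_left_mono[of "real n" "sqrt Y" "sqrt Y"] by (simp add: field_simps)
      moreover have "1 \<le> sqrt Y" using Y by simp
      ultimately have 1: "1 \<le> Y / real n" by linarith
      have "ln Y / 2 \<le> ln (Y / real n)"
        using Yn Y 1 by (subst ln_sqrt[symmetric]) (auto simp del: ln_sqrt)
      then have "c * (Y / real n) * (ln Y / 2) ^ m \<le> c * (Y / real n) * ln (Y / real n) ^ m"
        using c Y by (intro mult_left_mono power_mono) auto
      also have "\<dots> \<le> real (card (box_products q m (Y / real n)))" by (rule c(2)[OF 1])
      finally show "c * (Y / real n) * (ln Y / 2) ^ m \<le> real (card (box_products q m (Y / real n)))" .
    qed
    also have "\<dots> \<le> (\<Sum>n | n \<ge> 1 \<and> real n \<le> Y. real (card (box_products q m (Y / real n))))"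
      using N sq by (intro sum_mono2 finite_nat_le_real) auto
    also have "\<dots> = real (card (box_products q (Suc m) Y))"
      by (simp only: card_box_products_Suc[where r = r and q = q, OF Suc.prems q] of_nat_sum)
    finally show ?thesis .
  qed
  with c(1) show ?case by (intro exI[of _ "c / 2 ^ Suc m"]) auto
qed

section \<open>A sparse set with many \<open>k\<close>-fold products\<close>

text \<open>Doubling \<open>p\<close> until it passes \<open>g\<close> overshoots by at most a
  factor 2, unless \<open>p\<close> exceeds \<open>g\<close> at once. This moves a prime to a
  prescribed size without adding odd prime factors.\<close>

lemma power_of_2_rescale:
  fixes g :: real and p :: nat
  assumes "p > 0" "g \<ge> 0"
  shows "\<exists>e. g < real (p * 2 ^ e) \<and> real (p * 2 ^ e) \<le> real p + 2 * g"
proof -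
  define e where "e = (LEAST e. g < real (p * 2 ^ e))"
  obtain e0 where "g < 2 ^ e0" using real_arch_pow[of 2 g] by auto
  also have "2 ^ e0 \<le> real (p * 2 ^ e0)" using assms by simp
  finally have e: "g < real (p * 2 ^ e)" unfolding e_def by (rule LeastI)
  moreover have "real (p * 2 ^ e) \<le> real p + 2 * g"
  proof (cases e)
    case (Suc e')
    then have "\<not> g < real (p * 2 ^ e')" unfolding e_def using not_less_Least[of e'] by (metis lessI)
    then show ?thesis using Suc by simp
  qed (use assms in simp)
  ultimately show ?thesis by blast
qed

text \<open>Elements of size at least \<open>g n\<close> make \<open>D\<close> sparse. The matching
  upper bound, a factor \<open>M\<close> of order \<open>ln X powr (2 * \<alpha>)\<close> times the
  squared index, keeps products below \<open>X\<close> while the indices multiply to at most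
  \<open>Y = sqrt (X / M ^ k)\<close>; there are about \<open>Y * ln Y ^ (k - 1)\<close> of
  these.\<close>

lemma dense_products:
  fixes k :: nat and \<alpha> :: real
  assumes k: "k \<ge> 1" and \<alpha>: "\<alpha> \<ge> 0"
  obtains D C X0 c where "C > 0" "c > 0"
    "\<And>X. X \<ge> X0 \<Longrightarrow> real (countfn D X) \<le> C * sqrt X / ln X powr \<alpha>"
    "\<And>X. X \<ge> X0 \<Longrightarrow> c * sqrt X * ln X powr (real k - 1 - real k * \<alpha>) \<le> real (countfn (setpow D k) X)"
proof -
  obtain p :: "nat \<Rightarrow> nat" where p: "inj p" "\<And>m. prime (p m)" "\<And>m. odd (p m)" "\<And>m. p m \<le> 16 * (m + 3)\<^sup>2"
    using odd_prime_sequence by metis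
  define g where "g n = (real n * ln (real n + 3) powr \<alpha>)\<^sup>2" for n
  have "\<exists>e. g n < real (p n * 2 ^ e) \<and> real (p n * 2 ^ e) \<le> real (p n) + 2 * g n" for n
    by (rule power_of_2_rescale) (auto simp: g_def p prime_gt_0_nat)
  then obtain e where e: "\<And>n. g n < real (p n * 2 ^ e n)" "\<And>n. real (p n * 2 ^ e n) \<le> real (p n) + 2 * g n"
    by metis
  define d where "d n = p n * 2 ^ e n" for n
  define D where "D = d ` {1..}"
  have "real (countfn D X) \<le> 4 powr \<alpha> * sqrt X / ln X powr \<alpha>"
    if X: "X > 1" "X powr (1/4) \<le> sqrt X / ln X powr \<alpha>" for X
  proof -
    define T where "T = 4 powr \<alpha> * sqrt X / ln X powr \<alpha>"
    have T: "0 \<le> T" "X powr (1/4) \<le> T"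
      using X \<alpha> ge_one_powr_ge_zero[of 4 \<alpha>] mult_right_mono[of 1 "4 powr \<alpha>" "sqrt X / ln X powr \<alpha>"]
      by (auto simp: T_def)
    have "{x \<in> D. 1 \<le> x \<and> real x \<le> X} \<subseteq> d ` {1..nat \<lfloor>T\<rfloor>}"
    proof
      fix x assume "x \<in> {x \<in> D. 1 \<le> x \<and> real x \<le> X}"
      then obtain n where n: "n \<ge> 1" "x = d n" "real (d n) \<le> X" by (auto simp: D_def)
      have "g n < X" using e(1)[of n] n by (simp add: d_def)
      then have less: "real n * ln (real n + 3) powr \<alpha> < sqrt X"
        unfolding g_def by (rule real_less_rsqrt)
      \<comment> \<open>Indices up to the fourth root of \<open>X\<close> are covered by the
        assumption on \<open>X\<close>. Beyond it \<open>ln (n + 3) \<ge> ln X / 4\<close>, the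
        source of \<open>4 powr \<alpha>\<close>.\<close>
      have "real n \<le> T"
      proof (cases "real n \<le> X powr (1/4)")
        case False
        then have "X powr (1/4) \<le> real n + 3" by simp
        then have "ln (X powr (1/4)) \<le> ln (real n + 3)"
          using X by (subst ln_le_cancel_iff) auto
        then have "(ln X / 4) powr \<alpha> \<le> ln (real n + 3) powr \<alpha>"
          using X \<alpha> by (intro powr_mono2) (auto simp: ln_powr)
        then have "real n * (ln X / 4) powr \<alpha> \<le> sqrt X"
          using less mult_left_mono[of "(ln X / 4) powr \<alpha>" "ln (real n + 3) powr \<alpha>" "real n"] by linarith
        then show ?thesis using X by (simp add: T_def powr_divide field_simps)
      qed (use T in linarith)
      then show "x \<in> d ` {1..nat \<lfloor>T\<rfloor>}" using n by (auto simp: le_nat_floor)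
    qed
    then have "countfn D X \<le> card (d ` {1..nat \<lfloor>T\<rfloor>})"
      unfolding countfn_def by (intro card_mono) auto
    also have "\<dots> \<le> nat \<lfloor>T\<rfloor>" using card_image_le[of "{1..nat \<lfloor>T\<rfloor>}" d] by simp
    finally show ?thesis using T unfolding T_def[symmetric] by linarith
  qed
  moreover have "\<forall>\<^sub>F X in at_top. X > 1 \<and> X powr (1/4) \<le> sqrt X / ln X powr \<alpha>"
    by (intro eventually_conj; real_asymp)
  ultimately have upper: "\<forall>\<^sub>F X in at_top. real (countfn D X) \<le> 4 powr \<alpha> * sqrt X / ln X powr \<alpha>"
    by (auto elim!: eventually_mono)

  \<comment> \<open>residue classes of indices modulo \<open>k\<close> keep the \<open>k\<close> factors apart\<close>
  define q where "q i n = d (k * n + i)" for i n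
  define m where "m = k - 1"
  have km: "k = Suc m" using k by (simp add: m_def)
  have q0: "q i n > 0" for i n using p(2) by (simp add: q_def d_def prime_gt_0_nat)
  \<comment> \<open>An odd prime does not divide the power of 2, so divisibility means equality of
    primes, hence of indices; the residue modulo \<open>k\<close> then gives \<open>i\<close>, and
    the quotient gives \<open>n\<close>.\<close>
  have marker: "p (k * n + i) dvd q j n' \<longleftrightarrow> i = j \<and> n = n'" if "i \<le> m" "j \<le> m" for i j n n'
  proof -
    have "\<not> p (k * n + i) dvd 2 ^ l" for l
    proof
      assume "p (k * n + i) dvd 2 ^ l"
      then have "p (k * n + i) dvd 2" using p(2) prime_dvd_power by blast
      then have "p (k * n + i) = 2" using p(2) primes_dvd_imp_eq two_is_prime_nat by blast
      then show False using p(3)[of "k * n + i"] by simp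
    qed
    then have "p (k * n + i) dvd q j n' \<longleftrightarrow> p (k * n + i) dvd p (k * n' + j)"
      using p(2) by (simp add: q_def d_def prime_dvd_mult_iff)
    also have "\<dots> \<longleftrightarrow> p (k * n + i) = p (k * n' + j)"
      using p(2) primes_dvd_imp_eq by (metis dvd_refl)
    also have "\<dots> \<longleftrightarrow> k * n + i = k * n' + j" using p(1) by (simp add: inj_eq)
    also have "\<dots> \<longleftrightarrow> i = j \<and> n = n'"
    proof
      assume eq: "k * n + i = k * n' + j"
      have "i < k" "j < k" using that km by auto
      then have "(k * n + i) mod k = i" "(k * n' + j) mod k = j" by auto
      with eq have "i = j" by simp
      then show "i = j \<and> n = n'" using eq k by simp
    qed simp
    finally show ?thesis .
  qed
  obtain c where c: "c > 0" "\<And>Y. Y \<ge> 1 \<Longrightarrow> c * Y * ln Y ^ m \<le> real (card (box_products q m Y))"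
    using card_box_products_ge[of "\<lambda>i n. p (k * n + i)" m q, OF p(2) marker q0] by auto

  \<comment> \<open>For \<open>N = k * n + i\<close>, the bounds
    \<open>p N \<le> 256 * N ^ 2\<close> and \<open>2 * g N\<close> give the factor 258,
    \<open>N \<le> 2 * k * n\<close> gives \<open>4 * k ^ 2\<close>, and
    \<open>ln (N + 3) \<le> 2 * L\<close> gives the power of 2.\<close>
  define K where "K = 1032 * (real k)\<^sup>2 * (2 powr \<alpha>)\<^sup>2"
  have K: "K \<ge> 1"
  proof -
    have "1 \<le> (real k)\<^sup>2" "1 \<le> (2 powr \<alpha>)\<^sup>2" using k \<alpha> by (auto intro!: one_le_power ge_one_powr_ge_zero)
    then have "1 * 1 \<le> (real k)\<^sup>2 * (2 powr \<alpha>)\<^sup>2" by (intro mult_mono) auto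
    then show ?thesis by (simp add: K_def)
  qed
  \<comment> \<open>The root comes from \<open>K ^ k\<close> inside \<open>Y\<close>, and
    \<open>4 ^ m\<close> from \<open>ln Y \<ge> L / 4\<close>.\<close>
  define c' where "c' = c / (sqrt (K ^ k) * 4 ^ m)"
  have "c' * sqrt X * ln X powr (real k - 1 - real k * \<alpha>) \<le> real (countfn (setpow D k) X)"
    if X: "X \<ge> 2 * real k + 3" "ln X \<ge> 1" "K ^ k * (ln X powr (real k * \<alpha>))\<^sup>2 \<le> sqrt X" for X
  proof -
    define L where "L = ln X"
    define M where "M = K * (L powr \<alpha>)\<^sup>2"
    \<comment> \<open>Makes \<open>M ^ k * Y ^ 2 = X\<close>. The third assumption on
      \<open>X\<close> says \<open>M ^ k \<le> sqrt X\<close>, so \<open>Y\<close> is at least the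
      fourth root of \<open>X\<close>.\<close>
    define Y where "Y = sqrt (X / M ^ k)"
    have X1: "X \<ge> 1" using X by linarith
    have L: "L \<ge> 1" using X by (simp add: L_def)
    have L\<alpha>: "1 \<le> (L powr \<alpha>)\<^sup>2" using L \<alpha> by (auto intro!: one_le_power ge_one_powr_ge_zero)
    have M: "M \<ge> 1" using K L\<alpha> mult_mono[of 1 K 1 "(L powr \<alpha>)\<^sup>2"] by (simp add: M_def)
    have "L powr (real k * \<alpha>) = (L powr \<alpha>) ^ k"
      using L by (simp add: powr_powr[symmetric] powr_realpow mult.commute)
    then have Mk: "M ^ k = K ^ k * (L powr (real k * \<alpha>))\<^sup>2"
      by (simp add: M_def power_mult_distrib mult.commute flip: power_mult)
    have Mk1: "1 \<le> M ^ k" using M by simp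
    have MX: "M ^ k \<le> sqrt X" using X by (simp add: Mk L_def)
    have "X / M ^ k \<le> X / 1" using Mk1 X1 by (intro divide_left_mono) auto
    also have "\<dots> \<le> X\<^sup>2" using X1 by (simp add: power2_eq_square)
    finally have YX: "Y \<le> X" unfolding Y_def using X1 by (intro real_le_lsqrt) auto
    have "sqrt X * M ^ k \<le> sqrt X * sqrt X" using MX X1 by (intro mult_left_mono) auto
    then have "sqrt X \<le> X / M ^ k" using Mk1 X1 by (simp add: field_simps)
    then have Y4: "sqrt (sqrt X) \<le> Y" unfolding Y_def by simp
    moreover have "1 \<le> sqrt (sqrt X)" using X1 by simp
    ultimately have Y1: "1 \<le> Y" by linarith
    have "ln X / 4 = ln (sqrt (sqrt X))" using X1 by (simp add: ln_sqrt)
    also have "\<dots> \<le> ln Y" using Y4 Y1 X1 by (subst ln_le_cancel_iff) auto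
    finally have lnY: "L / 4 \<le> ln Y" by (simp add: L_def)

    have bound: "real (q i n) \<le> M * (real n)\<^sup>2" if "i \<le> m" "n \<ge> 1" "real n \<le> X" for i n
    proof -
      define N where "N = k * n + i"
      have N: "1 \<le> N" "N \<le> 2 * k * n"
      proof -
        show "1 \<le> N" using mult_le_mono[of 1 k 1 n] k that unfolding N_def by linarith
        have "i \<le> k * 1" using that km by simp
        also have "\<dots> \<le> k * n" using that by (intro mult_left_mono) auto
        finally show "N \<le> 2 * k * n" by (simp add: N_def)
      qed
      have rN: "real N \<le> 2 * real k * real n"
        using of_nat_mono[OF N(2), where 'a = real] by simp
      define \<Lambda> where "\<Lambda> = (ln (real N + 3) powr \<alpha>)\<^sup>2"
      have "exp 1 \<le> real N + 3" using exp_le by linarith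
      then have ln1: "1 \<le> ln (real N + 3)" by (simp add: ln_ge_iff)
      then have \<Lambda>1: "1 \<le> \<Lambda>" unfolding \<Lambda>_def using \<alpha> by (auto intro!: one_le_power ge_one_powr_ge_zero)
      \<comment> \<open>With \<open>n \<le> X\<close> and \<open>2 * k + 3 \<le> X\<close>, the
        argument of the logarithm is at most \<open>X * X\<close>, so one \<open>L\<close> serves
        for all indices.\<close>
      have "real N + 3 \<le> 2 * real k * X + 3"
        using rN that k mult_left_mono[of "real n" X "2 * real k"] by linarith
      also have "\<dots> \<le> (2 * real k + 3) * X" using X1 by (simp add: distrib_right)
      also have "\<dots> \<le> X * X" using X X1 by (intro mult_right_mono) auto
      finally have "ln (real N + 3) \<le> ln (X * X)" using X1 by (subst ln_le_cancel_iff) auto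
      also have "\<dots> = 2 * L" using X1 by (simp add: ln_mult L_def)
      finally have "ln (real N + 3) powr \<alpha> \<le> (2 * L) powr \<alpha>"
        using \<alpha> ln1 by (intro powr_mono2) auto
      then have \<Lambda>: "\<Lambda> \<le> (2 powr \<alpha>)\<^sup>2 * (L powr \<alpha>)\<^sup>2"
        unfolding \<Lambda>_def using L by (simp add: powr_mult flip: power_mult_distrib)
      have "p N \<le> 16 * (4 * N)\<^sup>2" using p(4)[of N] N by (intro order.trans[OF p(4)] mult_left_mono power_mono) auto
      then have "real (p N) \<le> real (256 * N\<^sup>2)" unfolding of_nat_le_iff by (simp add: power_mult_distrib)
      then have pN: "real (p N) \<le> 256 * (real N)\<^sup>2" by simp
      have "real (q i n) \<le> 256 * (real N)\<^sup>2 + 2 * ((real N)\<^sup>2 * \<Lambda>)"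
        using e(2)[of N] pN by (simp add: q_def d_def N_def[symmetric] g_def \<Lambda>_def power_mult_distrib)
      also have "\<dots> \<le> 256 * ((real N)\<^sup>2 * \<Lambda>) + 2 * ((real N)\<^sup>2 * \<Lambda>)"
        using mult_left_mono[OF \<Lambda>1, of "(real N)\<^sup>2"] by (simp add: mult.commute)
      also have "\<dots> = 258 * ((real N)\<^sup>2 * \<Lambda>)" by simp
      also have "\<dots> \<le> 258 * ((2 * real k * real n)\<^sup>2 * ((2 powr \<alpha>)\<^sup>2 * (L powr \<alpha>)\<^sup>2))"
        using rN \<Lambda> \<Lambda>1 by (intro mult_left_mono mult_mono power_mono) auto
      also have "\<dots> = M * (real n)\<^sup>2" by (simp add: M_def K_def power_mult_distrib)
      finally show ?thesis .
    qed

    have "box_products q m Y \<subseteq> {s \<in> setpow D k. 1 \<le> s \<and> real s \<le> X}"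
    proof
      fix s assume s: "s \<in> box_products q m Y"
      have "q i n \<in> D" if "n \<ge> 1" for i n
        using that k unfolding D_def q_def by (intro imageI) (simp add: Suc_le_eq)
      then have "s \<in> setpow D k"
        using box_products_subset_setpow[of m q D Y] s unfolding km by blast
      moreover have "s > 0" by (rule box_products_pos[OF q0 s])
      moreover have "real s \<le> M ^ Suc m * Y\<^sup>2"
        using bound YX s M by (intro box_products_le[of M m X q Y s]) auto
      moreover have "M ^ Suc m * Y\<^sup>2 = X" unfolding km[symmetric] Y_def using M X1 by simp
      ultimately show "s \<in> {s \<in> setpow D k. 1 \<le> s \<and> real s \<le> X}" by simp
    qed
    then have "card (box_products q m Y) \<le> countfn (setpow D k) X"
      unfolding countfn_def by (intro card_mono finite_subset[OF _ finite_nat_le_real[of X]]) auto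
    then have "c * Y * ln Y ^ m \<le> real (countfn (setpow D k) X)"
      using c(2)[OF Y1] by linarith
    moreover have "c * Y * (L / 4) ^ m \<le> c * Y * ln Y ^ m"
      using c(1) Y1 lnY L by (intro mult_left_mono power_mono) auto
    moreover have "c * Y * (L / 4) ^ m = c' * sqrt X * L powr (real k - 1 - real k * \<alpha>)"
    proof -
      have "L powr (real k - 1 - real k * \<alpha>) = L ^ m / L powr (real k * \<alpha>)"
        using L by (simp add: km powr_diff powr_realpow)
      moreover have "Y = sqrt X / (sqrt (K ^ k) * L powr (real k * \<alpha>))"
        by (simp add: Y_def Mk real_sqrt_divide real_sqrt_mult)
      ultimately show ?thesis by (simp add: c'_def power_divide)
    qed
    ultimately show ?thesis unfolding L_def by linarith
  qed
  moreover have "\<forall>\<^sub>F X in at_top. X \<ge> 2 * real k + 3 \<and> ln X \<ge> 1 \<and> K ^ k * (ln X powr (real k * \<alpha>))\<^sup>2 \<le> sqrt X"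
  proof (intro eventually_conj)
    define K' where "K' = K ^ k"
    define b where "b = real k * \<alpha>"
    have "K' > 0" "b \<ge> 0" using K \<alpha> by (auto simp: K'_def b_def)
    then show "\<forall>\<^sub>F X in at_top. K ^ k * (ln X powr (real k * \<alpha>))\<^sup>2 \<le> sqrt X"
      unfolding K'_def[symmetric] b_def[symmetric] by real_asymp
  qed real_asymp+
  ultimately have lower: "\<forall>\<^sub>F X in at_top. c' * sqrt X * ln X powr (real k - 1 - real k * \<alpha>)
      \<le> real (countfn (setpow D k) X)"
    by (auto elim!: eventually_mono)
  from eventually_conj[OF upper lower] obtain X0 where
    "\<And>X. X \<ge> X0 \<Longrightarrow> real (countfn D X) \<le> 4 powr \<alpha> * sqrt X / ln X powr \<alpha> \<and>
      c' * sqrt X * ln X powr (real k - 1 - real k * \<alpha>) \<le> real (countfn (setpow D k) X)"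
    unfolding eventually_at_top_linorder by blast
  moreover have "c' > 0" using c(1) K by (simp add: c'_def)
  ultimately show ?thesis by (intro that[of "4 powr \<alpha>" c' X0 D]) auto
qed

section \<open>Additive complements\<close>

text \<open>Each round adds the \<open>b\<close> that covers most of the uncovered set. Every
  uncovered \<open>n\<close> is reached by exactly \<open>card S\<close> elements of
  \<open>T\<close>, so on average, hence for some \<open>b\<close>, the share
  \<open>card S / card T\<close> gets covered.\<close>

lemma greedy_cover:
  fixes U S T :: "nat set"
  assumes fin: "finite U" "finite S" "finite T"
    and shift: "\<And>n s. n \<in> U \<Longrightarrow> s \<in> S \<Longrightarrow> s \<le> n \<and> n - s \<in> T"
    and card: "card S \<le> card T" "0 < card T"
  shows "\<exists>B\<subseteq>T. card B \<le> r \<and>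
    real (card (U - setsum S B)) \<le> real (card U) * (1 - real (card S) / real (card T)) ^ r"
proof (induction r)
  case 0
  show ?case by (intro exI[of _ "{}"]) (auto intro!: card_mono fin)
next
  case (Suc r)
  define \<theta> where "\<theta> = 1 - real (card S) / real (card T)"
  have \<theta>: "0 \<le> \<theta>" using card by (simp add: \<theta>_def)
  from Suc obtain B where B: "B \<subseteq> T" "card B \<le> r"
      "real (card (U - setsum S B)) \<le> real (card U) * \<theta> ^ r"
    unfolding \<theta>_def by blast
  define V where "V = U - setsum S B"
  have V: "finite V" "V \<subseteq> U" using fin by (auto simp: V_def)
  have cardS: "card {b\<in>T. \<exists>s\<in>S. n = s + b} = card S" if "n \<in> V" for n
  proof -
    have "{b\<in>T. \<exists>s\<in>S. n = s + b} = (\<lambda>s. n - s) ` S"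
      using shift that V by (force simp: image_iff)
    moreover have "inj_on (\<lambda>s. n - s) S"
      unfolding inj_on_def using shift that V by (metis diff_diff_cancel subsetD)
    ultimately show ?thesis by (simp add: card_image)
  qed
  have "(\<Sum>b\<in>T. card {n\<in>V. \<exists>s\<in>S. n = s + b}) = (\<Sum>n\<in>V. card {b\<in>T. \<exists>s\<in>S. n = s + b})"
    by (rule sum_multicount_gen[symmetric]) (use fin V in auto)
  also have "\<dots> = card V * card S" by (simp add: cardS)
  finally have count: "(\<Sum>b\<in>T. card {n\<in>V. \<exists>s\<in>S. n = s + b}) = card V * card S" .
  \<comment> \<open>Pigeonhole on the double count: some term is at least the average.\<close>
  have "\<exists>b\<in>T. card V * card S \<le> card T * card {n\<in>V. \<exists>s\<in>S. n = s + b}"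
  proof (rule ccontr)
    assume "\<not> ?thesis"
    then have "(\<Sum>b\<in>T. card T * card {n\<in>V. \<exists>s\<in>S. n = s + b}) < (\<Sum>b\<in>T. card V * card S)"
      using fin card by (intro sum_strict_mono) (auto simp: not_le)
    then show False by (simp add: sum_distrib_left[symmetric] count)
  qed
  then obtain b where b: "b \<in> T" "card V * card S \<le> card T * card {n\<in>V. \<exists>s\<in>S. n = s + b}"
    by blast
  let ?W = "{n\<in>V. \<exists>s\<in>S. n = s + b}"
  have "real (card V) * real (card S) \<le> real (card T) * real (card ?W)"
    using b(2) by (simp flip: of_nat_mult)
  then have W: "real (card V) * (real (card S) / real (card T)) \<le> real (card ?W)"
    using card by (simp add: field_simps)
  have "U - setsum S (insert b B) = V - ?W"
    by (auto simp: V_def setsum_def)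
  then have "real (card (U - setsum S (insert b B))) = real (card V) - real (card ?W)"
    using V by (simp add: card_Diff_subset card_mono of_nat_diff)
  also have "\<dots> \<le> real (card V) * \<theta>"
    using W by (simp add: \<theta>_def right_diff_distrib)
  also have "\<dots> \<le> (real (card U) * \<theta> ^ r) * \<theta>"
    using B(3) \<theta> by (intro mult_right_mono) (auto simp: V_def)
  finally have "real (card (U - setsum S (insert b B))) \<le> real (card U) * \<theta> ^ Suc r"
    by (simp add: mult.commute mult.left_commute)
  moreover have "card (insert b B) \<le> Suc r"
    using card_insert_le_m1[of "Suc r" B b] B(2) by simp
  ultimately show ?case using B(1) b(1) unfolding \<theta>_def by (intro exI[of _ "insert b B"]) auto
qed

text \<open>With \<open>r\<close> the rounded-up number of rounds,
  \<open>(1 - ?\<theta>) ^ r \<le> 1 / (card U + 1)\<close>, so fewer than one element stays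
  uncovered. The last \<open>+ 1\<close> in the bound pays for the rounding.\<close>

lemma logarithmic_cover:
  fixes U S T :: "nat set"
  assumes fin: "finite U" "finite S" "finite T"
    and shift: "\<And>n s. n \<in> U \<Longrightarrow> s \<in> S \<Longrightarrow> s \<le> n \<and> n - s \<in> T"
    and card: "card S \<le> card T" "0 < card S"
  shows "\<exists>B\<subseteq>T. U \<subseteq> setsum S B \<and>
    real (card B) \<le> real (card T) / real (card S) * ln (real (card U) + 1) + 1"
proof -
  let ?l = "real (card T) / real (card S) * ln (real (card U) + 1)"
  let ?\<theta> = "real (card S) / real (card T)"
  define r where "r = nat \<lceil>?l\<rceil>"
  have l: "0 \<le> ?l" by simp
  have r: "?l \<le> real r" "real r \<le> ?l + 1"
    using l by (auto simp: r_def)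
  obtain B where B: "B \<subseteq> T" "card B \<le> r"
      "real (card (U - setsum S B)) \<le> real (card U) * (1 - ?\<theta>) ^ r"
    using greedy_cover[OF fin shift, of r] card by auto
  have "(1 - ?\<theta>) ^ r \<le> exp (- ?\<theta>) ^ r"
    using exp_ge_add_one_self[of "- ?\<theta>"] card by (intro power_mono) auto
  also have "\<dots> = exp (- (?\<theta> * real r))" by (simp add: exp_of_nat_mult[symmetric] mult.commute)
  also have "\<dots> \<le> exp (- ln (real (card U) + 1))"
    using mult_left_mono[OF r(1), of ?\<theta>] card by simp
  also have "\<dots> = 1 / (real (card U) + 1)" by (simp add: exp_minus field_simps)
  finally have "real (card U) * (1 - ?\<theta>) ^ r \<le> real (card U) * (1 / (real (card U) + 1))"
    by (rule mult_left_mono) simp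
  also have "\<dots> < 1" by simp
  finally have "card (U - setsum S B) = 0" using B(3) by simp
  then have "U \<subseteq> setsum S B" using fin by simp
  moreover have "real (card B) \<le> ?l + 1" using B(2) r(2) by linarith
  ultimately show ?thesis using B(1) by blast
qed

section \<open>Assembling the complement from blocks between powers of 16\<close>

text \<open>Since \<open>j powr \<alpha>\<close> at most doubles from \<open>j\<close> to
  \<open>j + 1\<close>, the terms at least double, and the last one dominates as in a geometric
  series.\<close>

lemma sum_4_powr_le:
  fixes \<alpha> :: real
  assumes "0 \<le> \<alpha>" "\<alpha> \<le> 1" "J \<ge> 1"
  shows "(\<Sum>j=1..J. 4 ^ j / real j powr \<alpha>) \<le> 2 * 4 ^ J / real J powr \<alpha>"
  using assms(3)
proof (induction J rule: dec_induct)
  case (step J)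
  have "real (Suc J) powr \<alpha> \<le> (2 * real J) powr \<alpha>"
    using step assms by (intro powr_mono2) auto
  also have "\<dots> = 2 powr \<alpha> * real J powr \<alpha>" by (simp add: powr_mult)
  also have "\<dots> \<le> 2 * real J powr \<alpha>"
    using powr_mono[of \<alpha> 1 2] assms by (intro mult_right_mono) auto
  finally have "2 * 4 ^ J / real J powr \<alpha> \<le> 4 ^ Suc J / real (Suc J) powr \<alpha>"
    using step by (simp add: field_simps del: of_nat_Suc)
  with step.IH show ?case by simp
qed auto

text \<open>The block from \<open>16 ^ (j + 1)\<close> to \<open>16 ^ (j + 2)\<close> is covered
  using the elements of \<open>S\<close> up to \<open>16 ^ j\<close>, so all shifts stay at or above
  \<open>16 ^ j\<close>. The cost is of order
  \<open>16 ^ j / (4 ^ j * j powr (1 + \<alpha>)) * j\<close>, that is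
  \<open>4 ^ j / j powr \<alpha>\<close>.\<close>

lemma lorentz_complement:
  fixes S :: "nat set" and c \<alpha> X0 :: real
  assumes "c > 0" and \<alpha>: "0 \<le> \<alpha>" "\<alpha> \<le> 1"
    and dense: "\<And>X. X \<ge> X0 \<Longrightarrow> c * sqrt X * ln X powr (1 + \<alpha>) \<le> real (countfn S X)"
  shows "\<exists>B N C. {N..} \<subseteq> setsum S B \<and> C > 0 \<and>
    (\<forall>X\<ge>16. real (countfn B X) \<le> C * sqrt X / ln X powr \<alpha>)"
proof -
  \<comment> \<open>Here 768 is 256 from \<open>card ?T \<le> 256 * 16 ^ j\<close> times 3 from
    \<open>j + 2 \<le> 3 * j\<close>. The \<open>+ 1\<close> absorbs the additive 1 of the cover, as
    \<open>4 ^ j / j powr \<alpha> \<ge> 1\<close>.\<close>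
  define C where "C = 768 * ln 16 / c + 1"
  have ln16: "1 \<le> ln (16::real)" using exp_le by (simp add: ln_ge_iff)
  have C: "C > 0" using assms ln16 by (simp add: C_def add_pos_pos)
  define j0 where "j0 = max 1 (nat \<lceil>X0\<rceil>)"
  have "\<exists>B\<subseteq>{16 ^ j..16 ^ (j + 2)}. {16 ^ (j + 1)..16 ^ (j + 2)} \<subseteq> setsum S B \<and>
      real (card B) \<le> C * (4 ^ j / real j powr \<alpha>)" if j: "j \<ge> j0" for j
  proof -
    let ?U = "{16 ^ (j + 1)..16 ^ (j + 2)} :: nat set" and ?T = "{16 ^ j..16 ^ (j + 2)} :: nat set"
    let ?S = "{s\<in>S. 1 \<le> s \<and> real s \<le> 16 ^ j}"
    have j1: "j \<ge> 1" using j by (simp add: j0_def)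
    have Sj: "?S \<subseteq> {1..16 ^ j}" by (auto simp flip: of_nat_le_iff)
    have pow: "(16::nat) ^ j \<ge> 1" by simp
    have "card ?T = 256 * 16 ^ j + 1 - 16 ^ j" by simp
    with pow have "card ?T \<le> 256 * 16 ^ j" and cT: "16 ^ j \<le> card ?T" by linarith+
    then have cT': "real (card ?T) \<le> 256 * 16 ^ j" by (simp flip: of_nat_le_iff[where 'a = real])
    have "card ?U = 256 * 16 ^ j + 1 - 16 * 16 ^ j" by simp
    with pow have "card ?U + 1 \<le> 256 * 16 ^ j" by linarith
    then have "real (card ?U + 1) \<le> real (256 * 16 ^ j)" by (simp only: of_nat_le_iff)
    then have cU: "real (card ?U) + 1 \<le> 16 ^ (j + 2)" by simp
    have "X0 \<le> real j" using j by (simp add: j0_def)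
    also have "\<dots> \<le> 2 ^ j" by (rule less_imp_le[OF of_nat_less_two_power])
    also have "\<dots> \<le> 16 ^ j" by (rule power_mono) auto
    finally have "c * sqrt (16 ^ j) * ln (16 ^ j) powr (1 + \<alpha>) \<le> real (card ?S)"
      using dense[of "16 ^ j"] by (simp add: countfn_def)
    moreover have "sqrt (16 ^ j) = 4 ^ j" by (simp add: real_sqrt_power)
    moreover have "real j powr (1 + \<alpha>) \<le> ln (16 ^ j) powr (1 + \<alpha>)"
      using \<alpha> ln16 mult_left_mono[OF ln16, of "real j"] by (intro powr_mono2) (auto simp: ln_realpow)
    then have "c * 4 ^ j * real j powr (1 + \<alpha>) \<le> c * 4 ^ j * ln (16 ^ j) powr (1 + \<alpha>)"
      using assms by (intro mult_left_mono) auto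
    ultimately have cS: "c * 4 ^ j * real j powr (1 + \<alpha>) \<le> real (card ?S)" by simp
    moreover have "0 < c * 4 ^ j * real j powr (1 + \<alpha>)" using assms j1 by simp
    ultimately have S0: "0 < card ?S" by linarith
    have "card ?S \<le> 16 ^ j" using card_mono[OF _ Sj] by simp
    then have le: "card ?S \<le> card ?T" using cT by linarith
    have shift: "s \<le> n \<and> n - s \<in> ?T" if "n \<in> ?U" "s \<in> ?S" for n s
      using that Sj by auto
    have finS: "finite ?S" using finite_subset[OF Sj] by simp
    obtain B where B: "B \<subseteq> ?T" "?U \<subseteq> setsum ?S B"
        "real (card B) \<le> real (card ?T) / real (card ?S) * ln (real (card ?U) + 1) + 1"
      using logarithmic_cover[OF finite_atLeastAtMost finS finite_atLeastAtMost shift le S0] by blast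
    have "ln (real (card ?U) + 1) \<le> ln (16 ^ (j + 2))" using cU by simp
    also have "\<dots> = (real j + 2) * ln 16" by (simp only: ln_realpow of_nat_add of_nat_numeral)
    also have "\<dots> \<le> (3 * real j) * ln 16" using j1 ln16 by (intro mult_right_mono) auto
    finally have "ln (real (card ?U) + 1) \<le> 3 * real j * ln 16" .
    then have "real (card ?T) / real (card ?S) * ln (real (card ?U) + 1)
        \<le> (256 * 16 ^ j) / (c * 4 ^ j * real j powr (1 + \<alpha>)) * (3 * real j * ln 16)"
      using cT' cS S0 assms j1 by (intro mult_mono frac_le) auto
    also have "\<dots> = 768 * ln 16 / c * (4 ^ j / real j powr \<alpha>)"
    proof -
      have "(16::real) ^ j = 4 ^ j * 4 ^ j" by (simp flip: power_mult_distrib)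
      then show ?thesis using assms j1 by (simp add: powr_add field_simps)
    qed
    finally have "real (card B) \<le> 768 * ln 16 / c * (4 ^ j / real j powr \<alpha>) + 1" using B(3) by linarith
    moreover have "1 \<le> 4 ^ j / real j powr \<alpha>"
    proof -
      have "real j powr \<alpha> \<le> real j powr 1" using \<alpha> j1 by (intro powr_mono) auto
      also have "\<dots> \<le> 4 ^ j" using of_nat_less_two_power[of j] power_mono[of 2 "4::real" j] j1 by simp
      finally show ?thesis using j1 by simp
    qed
    ultimately have "real (card B) \<le> C * (4 ^ j / real j powr \<alpha>)"
      unfolding C_def distrib_right by linarith
    moreover have "setsum ?S B \<subseteq> setsum S B" by (auto simp: setsum_def)
    ultimately show ?thesis using B by blast
  qed
  then obtain B where B: "\<And>j. j \<ge> j0 \<Longrightarrow> B j \<subseteq> {16 ^ j..16 ^ (j + 2)}"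
      "\<And>j. j \<ge> j0 \<Longrightarrow> {16 ^ (j + 1)..16 ^ (j + 2)} \<subseteq> setsum S (B j)"
      "\<And>j. j \<ge> j0 \<Longrightarrow> real (card (B j)) \<le> C * (4 ^ j / real j powr \<alpha>)"
    by metis
  define B' where "B' = (\<Union>j\<in>{j0..}. B j)"
  \<comment> \<open>The 2 is from the geometric sum, the power from
    \<open>J \<ge> ln X / (2 * ln 16)\<close>.\<close>
  define C' where "C' = 2 * C * (2 * ln 16) powr \<alpha>"
  have "{16 ^ (j0 + 1)..} \<subseteq> setsum S B'"
  proof
    fix n assume n: "n \<in> {16 ^ (j0 + 1)::nat..}"
    moreover have "1 \<le> (16::nat) ^ (j0 + 1)" by simp
    ultimately have "1 \<le> n" unfolding atLeast_iff by linarith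
    then obtain i where i: "16 ^ i \<le> n" "n < 16 ^ (i + 1)"
      using ex_power_ivl1[of 16 n] by auto
    \<comment> \<open>Block \<open>l\<close> covers numbers from \<open>16 ^ (l + 1)\<close> on, so
      \<open>n\<close> belongs to \<open>l = i - 1\<close>, which must be at least
      \<open>j0\<close>.\<close>
    have "(16::nat) ^ (j0 + 1) < 16 ^ (i + 1)"
      using n unfolding atLeast_iff by (rule le_less_trans[OF _ i(2)])
    then have "j0 < i" by simp
    then obtain l where l: "i = l + 1" "l \<ge> j0" by (cases i) auto
    then have "n \<in> {16 ^ (l + 1)..16 ^ (l + 2)}" using i by simp
    then have "n \<in> setsum S (B l)" using B(2)[OF l(2)] by blast
    then show "n \<in> setsum S B'" using l(2) by (force simp: setsum_def B'_def)
  qed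
  moreover have "real (countfn B' X) \<le> C' * sqrt X / ln X powr \<alpha>" if X: "X \<ge> 16" for X
  proof -
    obtain J where J: "16 ^ J \<le> nat \<lfloor>X\<rfloor>" "nat \<lfloor>X\<rfloor> < 16 ^ (J + 1)"
      using ex_power_ivl1[of 16 "nat \<lfloor>X\<rfloor>"] X by (auto simp: le_nat_iff le_floor_iff)
    have "16 \<le> nat \<lfloor>X\<rfloor>" using X by (simp add: le_nat_floor)
    then have "(16::nat) ^ 1 < 16 ^ (J + 1)" using J(2) by simp
    then have J1: "J \<ge> 1" by (cases J) auto
    have XJ: "16 ^ J \<le> X" "X < 16 ^ (J + 1)"
    proof -
      have fl: "real (nat \<lfloor>X\<rfloor>) \<le> X" "X < real (nat \<lfloor>X\<rfloor>) + 1"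
        using X by linarith+
      have "real (16 ^ J) \<le> real (nat \<lfloor>X\<rfloor>)" "real (nat \<lfloor>X\<rfloor> + 1) \<le> real (16 ^ (J + 1))"
        using J by (simp_all only: of_nat_le_iff)
      then show "16 ^ J \<le> X" "X < 16 ^ (J + 1)" 
        using fl unfolding of_nat_add of_nat_power of_nat_numeral of_nat_1 by linarith+
    qed
    \<comment> \<open>Since \<open>B j\<close> starts at \<open>16 ^ j\<close>, blocks with
      \<open>j > J\<close> lie beyond \<open>X\<close>.\<close>
    have "{n \<in> B'. 1 \<le> n \<and> real n \<le> X} \<subseteq> (\<Union>j\<in>{j0..J}. B j)"
    proof
      fix n assume "n \<in> {n \<in> B'. 1 \<le> n \<and> real n \<le> X}"
      then obtain j where j: "j \<ge> j0" "n \<in> B j" "real n \<le> X" by (auto simp: B'_def)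
      then have "16 ^ j \<le> n" using B(1)[of j] by auto
      then have "16 ^ j \<le> real n" by simp
      then have "(16::real) ^ j < 16 ^ (J + 1)" using XJ j by linarith
      then have "j < J + 1" by (rule power_less_imp_less_exp[rotated]) simp
      then have "j \<le> J" by simp
      then show "n \<in> (\<Union>j\<in>{j0..J}. B j)" using j by auto
    qed
    moreover have fin: "finite (B j)" if "j \<ge> j0" for j
      using B(1)[OF that] finite_subset by blast
    ultimately have "countfn B' X \<le> card (\<Union>j\<in>{j0..J}. B j)"
      unfolding countfn_def by (intro card_mono) auto
    also have "\<dots> \<le> (\<Sum>j=j0..J. card (B j))" by (rule card_UN_le) simp
    finally have "real (countfn B' X) \<le> (\<Sum>j=j0..J. real (card (B j)))"
      by (simp flip: of_nat_sum)
    also have "\<dots> \<le> (\<Sum>j=j0..J. C * (4 ^ j / real j powr \<alpha>))"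
      using B(3) by (intro sum_mono) auto
    also have "\<dots> \<le> (\<Sum>j=1..J. C * (4 ^ j / real j powr \<alpha>))"
      using C by (intro sum_mono2) (auto simp: j0_def)
    also have "\<dots> = C * (\<Sum>j=1..J. 4 ^ j / real j powr \<alpha>)" by (simp only: sum_distrib_left)
    also have "\<dots> \<le> C * (2 * 4 ^ J / real J powr \<alpha>)"
      using C \<alpha> J1 by (intro mult_left_mono sum_4_powr_le) auto
    also have "\<dots> \<le> C * (2 * sqrt X / (ln X / (2 * ln 16)) powr \<alpha>)"
    proof -
      have "4 ^ J = sqrt (16 ^ J)" by (simp add: real_sqrt_power)
      also have "\<dots> \<le> sqrt X" using XJ by simp
      finally have "4 ^ J \<le> sqrt X" .
      moreover have "(ln X / (2 * ln 16)) powr \<alpha> \<le> real J powr \<alpha>"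
      proof (rule powr_mono2)
        have "ln X \<le> ln (16 ^ (J + 1))" using XJ X by (subst ln_le_cancel_iff) auto
        also have "\<dots> = (real J + 1) * ln 16" by (simp only: ln_realpow of_nat_add of_nat_1)
        also have "\<dots> \<le> (2 * real J) * ln 16" using J1 ln16 by (intro mult_right_mono) auto
        finally show "ln X / (2 * ln 16) \<le> real J" using ln16 by (simp add: field_simps)
      qed (use X ln16 \<alpha> in auto)
      moreover have "0 < ln X / (2 * ln 16)" using X ln16 by simp
      ultimately show ?thesis using C X J1 by (intro mult_left_mono frac_le) auto
    qed
    also have "\<dots> = C' * sqrt X / ln X powr \<alpha>"
      using X ln16 by (simp add: C'_def powr_divide)
    finally show ?thesis .
  qed
  moreover have "C' > 0" using C ln16 by (simp add: C'_def)
  ultimately show ?thesis by blast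
qed

section \<open>The construction\<close>

lemma setpow_mono:
  assumes "A \<subseteq> A'"
  shows "setpow A m \<subseteq> setpow A' m"
  using assms
proof (induction A m rule: setpow.induct)
  case (3 A m)
  then have "setpow A (Suc m) \<subseteq> setpow A' (Suc m)" by simp
  with 3 show ?case by (auto simp: setprod_def)
qed auto

lemma zero_in_setpow: "0 \<in> A \<Longrightarrow> 0 \<in> setpow A m"
  by (induction A m rule: setpow.induct) (auto simp: setprod_def)

lemma countfn_Un: "countfn (A \<union> B) X \<le> countfn A X + countfn B X"
proof -
  have "{n \<in> A \<union> B. 1 \<le> n \<and> real n \<le> X}
      = {n \<in> A. 1 \<le> n \<and> real n \<le> X} \<union> {n \<in> B. 1 \<le> n \<and> real n \<le> X}" by auto
  then show ?thesis unfolding countfn_def by (simp only: card_Un_le)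
qed

lemma countfn_le_card: "finite A \<Longrightarrow> countfn A X \<le> card A"
  unfolding countfn_def by (rule card_mono) auto

theorem theorem1p2:
  fixes k :: nat
  assumes "k \<ge> 2"
  shows "\<exists>A :: nat set. setsum (setpow A k) A = UNIV \<and>
    (\<exists>C > 0. \<exists>X0. \<forall>X \<ge> X0.
       real (countfn A X) \<le> C * sqrt X / (ln X) powr ((real k - 2) / (real k + 1)))"
proof -
  define \<alpha> where "\<alpha> = (real k - 2) / (real k + 1)"
  have \<alpha>: "0 \<le> \<alpha>" "\<alpha> \<le> 1" using assms by (auto simp: \<alpha>_def)
  have k1: "k \<ge> 1" using assms by simp
  \<comment> \<open>This equation determines \<open>\<alpha>\<close>: the cover costs one logarithm,
    and \<open>D\<close> and its complement then have the same order of size.\<close>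
  have exponent: "real k - 1 - real k * \<alpha> = 1 + \<alpha>"
    by (simp add: \<alpha>_def field_simps)
  obtain D C1 X1 c where D: "C1 > 0" "c > 0"
    "\<And>X. X \<ge> X1 \<Longrightarrow> real (countfn D X) \<le> C1 * sqrt X / ln X powr \<alpha>"
    "\<And>X. X \<ge> X1 \<Longrightarrow> c * sqrt X * ln X powr (1 + \<alpha>) \<le> real (countfn (setpow D k) X)"
    using dense_products[of k \<alpha>, unfolded exponent] k1 \<alpha>(1) by metis
  obtain B N C2 where B: "{N..} \<subseteq> setsum (setpow D k) B" "C2 > 0"
    "\<And>X. X \<ge> 16 \<Longrightarrow> real (countfn B X) \<le> C2 * sqrt X / ln X powr \<alpha>"
    using lorentz_complement[OF D(2) \<alpha> D(4)] by blast
  define A where "A = {..N} \<union> (D \<union> B)"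
  have "n \<in> setsum (setpow A k) A" for n
  proof (cases "n \<le> N")
    case True
    \<comment> \<open>The initial segment contains 0, so \<open>n = 0 + n\<close> represents every
      \<open>n \<le> N\<close>.\<close>
    moreover have "0 \<in> setpow A k" by (rule zero_in_setpow) (simp add: A_def)
    ultimately show ?thesis by (force simp: setsum_def A_def)
  next
    case False
    then have "n \<in> setsum (setpow D k) B" using B(1) by auto
    moreover have "setpow D k \<subseteq> setpow A k" by (rule setpow_mono) (auto simp: A_def)
    ultimately show ?thesis by (fastforce simp: setsum_def A_def)
  qed
  then have cover: "setsum (setpow A k) A = UNIV" by blast
  \<comment> \<open>Absorbs the finite initial segment into the bound, giving the 1 in
    \<open>1 + C1 + C2\<close>.\<close>
  have "\<forall>\<^sub>F X in at_top. real (N + 1) \<le> sqrt X / ln X powr \<alpha>"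
    using \<alpha> by real_asymp
  then obtain X2 where X2: "\<And>X. X \<ge> X2 \<Longrightarrow> real (N + 1) \<le> sqrt X / ln X powr \<alpha>"
    unfolding eventually_at_top_linorder by blast
  have "real (countfn A X) \<le> (1 + C1 + C2) * sqrt X / ln X powr \<alpha>"
    if X: "X \<ge> Max {X1, X2, 16}" for X
  proof -
    have "countfn A X \<le> (N + 1) + (countfn D X + countfn B X)"
      unfolding A_def
      using countfn_Un[of "{..N}" "D \<union> B" X] countfn_Un[of D B X] countfn_le_card[of "{..N}" X] by simp
    then have "real (countfn A X) \<le> real (N + 1) + (real (countfn D X) + real (countfn B X))"
      by linarith
    then have "real (countfn A X) \<le> sqrt X / ln X powr \<alpha>
        + (C1 * sqrt X / ln X powr \<alpha> + C2 * sqrt X / ln X powr \<alpha>)"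
      using X2[of X] D(3)[of X] B(3)[of X] X by simp
    then show ?thesis by (simp add: add_divide_distrib distrib_right)
  qed
  moreover have "1 + C1 + C2 > 0" using D B by simp
  ultimately show ?thesis using cover unfolding \<alpha>_def[symmetric] by blast
qed

end
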